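(* Let $k$ be a commutative ring and let $(A,\star,1)$ be a unital, not necessarily associative, $k$-algebra. Let $\mathrm{Twist}(A)$ be the set of twisting maps $\alpha:A\to A$ compatible with $A$, i.e. such that $(A,\star,\alpha,1)$ is a unital hom-associative algebra. Then $\mathrm{Twist}(A)$ forms a commutative associative algebra (not necessarily with multiplicative unit) with pointwise addition of functions as addition and composition as multiplication. Let $AC(A)$ be the set of elements $a\in A$ such that: \begin{enumerate} \item $a\star x=x\star a$ for all $x\in A$, and \item the set $A\star a=\{x\star a: x\in A\}$ forms an ideal in $A$, and every element of this ideal associates with every element of $A$. \end{enumerate} Then the elements of $\mathrm{Twist}(A)$ correspond one-to-one with the elements of $AC(A)$; the correspondence is given by the mutually inverse maps $\Phi:\mathrm{Twist}(A)\to AC(A)$ and $\Psi:AC(A)\to \mathrm{Twist}(A)$ defined by $$\Phi(\alpha):=\alpha(1),\qquad \Psi(x)(y):=x\star y .$$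
   Context: A hom-associative $k$-algebra $(A,\star,\alpha)$ is a $k$-module $A$ with a $k$-bilinear, not necessarily associative, product $\star$ and a $k$-linear map $\alpha:A\to A$ (the twisting map, not assumed multiplicative) such that $\alpha(x)\star(y\star z)=(x\star y)\star\alpha(z)$ for all $x,y,z\in A$. It is unital if there is an element $1\in A$ with $1\star x=x\star 1=x$ for all $x\in A$. An ideal means a two-sided ideal: a $k$-submodule stable under left and right multiplication by arbitrary elements of $A$. An element $b\in A$ "associates with every element of $A$" if $b\star(y\star z)=(b\star y)\star z$, $y\star(b\star z)=(y\star b)\star z$ and $y\star(z\star b)=(y\star z)\star b$ for all $y,z\in A$ (i.e. $b$ lies in the nucleus of $A$). *)

theory Defs
  imports "HOL-Algebra.Module"
begin

(* An algebra is a record of type module over R; the locale algebra of HOL-Algebra is not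
   usable here, since it demands an associative and commutative product with unit.
   The field one of the record is constrained only in unital_nonassoc_algebra. *)

locale nonassoc_algebra = module R A for R (structure) and A (structure) +
  assumes mult_closed:
      "\<lbrakk>x \<in> carrier A; y \<in> carrier A\<rbrakk> \<Longrightarrow> x \<otimes>\<^bsub>A\<^esub> y \<in> carrier A"
    and mult_l_distr:
      "\<lbrakk>x \<in> carrier A; y \<in> carrier A; z \<in> carrier A\<rbrakk> \<Longrightarrow>
        (x \<oplus>\<^bsub>A\<^esub> y) \<otimes>\<^bsub>A\<^esub> z = (x \<otimes>\<^bsub>A\<^esub> z) \<oplus>\<^bsub>A\<^esub> (y \<otimes>\<^bsub>A\<^esub> z)"
    and mult_r_distr:
      "\<lbrakk>x \<in> carrier A; y \<in> carrier A; z \<in> carrier A\<rbrakk> \<Longrightarrow>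
        x \<otimes>\<^bsub>A\<^esub> (y \<oplus>\<^bsub>A\<^esub> z) = (x \<otimes>\<^bsub>A\<^esub> y) \<oplus>\<^bsub>A\<^esub> (x \<otimes>\<^bsub>A\<^esub> z)"
    and mult_smult_l:
      "\<lbrakk>r \<in> carrier R; x \<in> carrier A; y \<in> carrier A\<rbrakk> \<Longrightarrow>
        (r \<odot>\<^bsub>A\<^esub> x) \<otimes>\<^bsub>A\<^esub> y = r \<odot>\<^bsub>A\<^esub> (x \<otimes>\<^bsub>A\<^esub> y)"
    and mult_smult_r:
      "\<lbrakk>r \<in> carrier R; x \<in> carrier A; y \<in> carrier A\<rbrakk> \<Longrightarrow>
        x \<otimes>\<^bsub>A\<^esub> (r \<odot>\<^bsub>A\<^esub> y) = r \<odot>\<^bsub>A\<^esub> (x \<otimes>\<^bsub>A\<^esub> y)"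

locale unital_nonassoc_algebra = nonassoc_algebra +
  assumes unit_closed: "\<one>\<^bsub>A\<^esub> \<in> carrier A"
    and unit_l: "x \<in> carrier A \<Longrightarrow> \<one>\<^bsub>A\<^esub> \<otimes>\<^bsub>A\<^esub> x = x"
    and unit_r: "x \<in> carrier A \<Longrightarrow> x \<otimes>\<^bsub>A\<^esub> \<one>\<^bsub>A\<^esub> = x"

locale comm_assoc_algebra = nonassoc_algebra +
  assumes mult_assoc:
      "\<lbrakk>x \<in> carrier A; y \<in> carrier A; z \<in> carrier A\<rbrakk> \<Longrightarrow>
        (x \<otimes>\<^bsub>A\<^esub> y) \<otimes>\<^bsub>A\<^esub> z = x \<otimes>\<^bsub>A\<^esub> (y \<otimes>\<^bsub>A\<^esub> z)"
    and mult_comm: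
      "\<lbrakk>x \<in> carrier A; y \<in> carrier A\<rbrakk> \<Longrightarrow> x \<otimes>\<^bsub>A\<^esub> y = y \<otimes>\<^bsub>A\<^esub> x"

locale hom_assoc_algebra = nonassoc_algebra +
  fixes \<alpha>
  assumes twist_closed: "x \<in> carrier A \<Longrightarrow> \<alpha> x \<in> carrier A"
    and twist_add:
      "\<lbrakk>x \<in> carrier A; y \<in> carrier A\<rbrakk> \<Longrightarrow> \<alpha> (x \<oplus>\<^bsub>A\<^esub> y) = \<alpha> x \<oplus>\<^bsub>A\<^esub> \<alpha> y"
    and twist_smult:
      "\<lbrakk>r \<in> carrier R; x \<in> carrier A\<rbrakk> \<Longrightarrow> \<alpha> (r \<odot>\<^bsub>A\<^esub> x) = r \<odot>\<^bsub>A\<^esub> \<alpha> x"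
    and hom_assoc:
      "\<lbrakk>x \<in> carrier A; y \<in> carrier A; z \<in> carrier A\<rbrakk> \<Longrightarrow>
        \<alpha> x \<otimes>\<^bsub>A\<^esub> (y \<otimes>\<^bsub>A\<^esub> z) = (x \<otimes>\<^bsub>A\<^esub> y) \<otimes>\<^bsub>A\<^esub> \<alpha> z"

locale unital_hom_assoc_algebra = unital_nonassoc_algebra + hom_assoc_algebra

(* A map on A is represented by its extensional representative, so that equality in Twist
   is equality of maps on the carrier. *)
definition Twist :: "('k, 'r) ring_scheme \<Rightarrow> ('k, 'a, 'm) module_scheme \<Rightarrow> ('a \<Rightarrow> 'a) set" where
  "Twist R A = {\<alpha> \<in> extensional (carrier A). unital_hom_assoc_algebra R A \<alpha>}"

(* The field one carries no meaning: there need not be a multiplicative unit. *)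
definition Twist_algebra ::
    "('k, 'r) ring_scheme \<Rightarrow> ('k, 'a, 'm) module_scheme \<Rightarrow> ('k, 'a \<Rightarrow> 'a) module" where
  "Twist_algebra R A =
    \<lparr> carrier = Twist R A,
      mult = (\<lambda>\<alpha> \<beta>. compose (carrier A) \<alpha> \<beta>),
      one = undefined,
      zero = (\<lambda>x\<in>carrier A. \<zero>\<^bsub>A\<^esub>),
      add = (\<lambda>\<alpha> \<beta>. \<lambda>x\<in>carrier A. \<alpha> x \<oplus>\<^bsub>A\<^esub> \<beta> x),
      smult = (\<lambda>r \<alpha>. \<lambda>x\<in>carrier A. r \<odot>\<^bsub>A\<^esub> \<alpha> x) \<rparr>"

definition algebra_ideal :: "('k, 'r) ring_scheme \<Rightarrow> ('k, 'a, 'm) module_scheme \<Rightarrow> 'a set \<Rightarrow> bool" where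
  "algebra_ideal R A I \<longleftrightarrow>
    submodule I R A \<and>
    (\<forall>x \<in> carrier A. \<forall>b \<in> I. x \<otimes>\<^bsub>A\<^esub> b \<in> I \<and> b \<otimes>\<^bsub>A\<^esub> x \<in> I)"

definition associates_with_all :: "('k, 'a, 'm) module_scheme \<Rightarrow> 'a \<Rightarrow> bool" where
  "associates_with_all A b \<longleftrightarrow>
    (\<forall>y \<in> carrier A. \<forall>z \<in> carrier A.
      b \<otimes>\<^bsub>A\<^esub> (y \<otimes>\<^bsub>A\<^esub> z) = (b \<otimes>\<^bsub>A\<^esub> y) \<otimes>\<^bsub>A\<^esub> z \<and>
      y \<otimes>\<^bsub>A\<^esub> (b \<otimes>\<^bsub>A\<^esub> z) = (y \<otimes>\<^bsub>A\<^esub> b) \<otimes>\<^bsub>A\<^esub> z \<and>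
      y \<otimes>\<^bsub>A\<^esub> (z \<otimes>\<^bsub>A\<^esub> b) = (y \<otimes>\<^bsub>A\<^esub> z) \<otimes>\<^bsub>A\<^esub> b)"

definition AC :: "('k, 'r) ring_scheme \<Rightarrow> ('k, 'a, 'm) module_scheme \<Rightarrow> 'a set" where
  "AC R A = {a \<in> carrier A.
    (\<forall>x \<in> carrier A. a \<otimes>\<^bsub>A\<^esub> x = x \<otimes>\<^bsub>A\<^esub> a) \<and>
    algebra_ideal R A {x \<otimes>\<^bsub>A\<^esub> a | x. x \<in> carrier A} \<and>
    (\<forall>b \<in> {x \<otimes>\<^bsub>A\<^esub> a | x. x \<in> carrier A}. associates_with_all A b)}"

definition Phi :: "('k, 'a, 'm) module_scheme \<Rightarrow> ('a \<Rightarrow> 'a) \<Rightarrow> 'a" where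
  "Phi A \<alpha> = \<alpha> \<one>\<^bsub>A\<^esub>"

definition Psi :: "('k, 'a, 'm) module_scheme \<Rightarrow> 'a \<Rightarrow> 'a \<Rightarrow> 'a" where
  "Psi A x = (\<lambda>y\<in>carrier A. x \<otimes>\<^bsub>A\<^esub> y)"

end

theory Submission
  imports Defs
begin

text \<open>
  Putting the unit into one slot of the hom-associativity law shows that a twisting map
  \<open>\<alpha>\<close> is multiplication by \<open>a = \<alpha> 1\<close>, on either side, and that it can be moved through products:
  \<open>\<alpha> (x y) = \<alpha> x \<cdot> y = x \<cdot> \<alpha> y\<close> (\<open>mult_twist_left\<close>, \<open>mult_twist_right\<close>). Once this is known,
  the full law reads \<open>\<alpha> (x (y z)) = \<alpha> ((x y) z)\<close> (\<open>twist_assoc\<close>). So the twisting maps are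
  exactly the elements of the centroid of \<open>A\<close> that annihilate every associator.

  Because \<open>\<alpha>\<close> moves through products, its image \<open>A a\<close> is an ideal, and each identity expressing
  that \<open>\<alpha> x\<close> lies in the nucleus says that \<open>\<alpha>\<close> annihilates an associator with entry \<open>x\<close>; hence
  \<open>a\<close> is in \<open>AC\<close>. Conversely, if \<open>a\<close> is in \<open>AC\<close>, then \<open>a = 1 a\<close> itself lies in \<open>A a\<close>, hence in
  the nucleus; being central as well, \<open>a\<close> can be pulled out of any product. That the multiples of
  \<open>a\<close> too are in the nucleus forces \<open>a ((x y) z) = a (x (y z))\<close>, which now amounts to
  hom-associativity of multiplication by \<open>a\<close> (\<open>Psi_in_Twist\<close>).

  Closure of the set of twisting maps under the linear operations is bilinearity, closure under
  composition is immediate from the centroid property, and two twisting maps commute because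
  \<open>\<alpha> (\<beta> x) = \<alpha> (\<beta> 1 \<cdot> x) = \<beta> 1 \<cdot> \<alpha> x = \<beta> (\<alpha> x)\<close> (\<open>compose_Twist_commute\<close>).
\<close>

section \<open>Twisting maps of a unital algebra\<close>

context unital_hom_assoc_algebra
begin

text \<open>Hom-associativity with \<open>x = y = 1\<close>, and with \<open>y = z = 1\<close>.\<close>

lemma twist_eq_left_mult:
  assumes "x \<in> carrier A"
  shows "\<alpha> \<one>\<^bsub>A\<^esub> \<otimes>\<^bsub>A\<^esub> x = \<alpha> x"
  using hom_assoc[of "\<one>\<^bsub>A\<^esub>" "\<one>\<^bsub>A\<^esub>" x] assms by (simp add: unit_closed unit_l twist_closed)

lemma twist_eq_right_mult:
  assumes "x \<in> carrier A"
  shows "x \<otimes>\<^bsub>A\<^esub> \<alpha> \<one>\<^bsub>A\<^esub> = \<alpha> x"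
  using hom_assoc[of x "\<one>\<^bsub>A\<^esub>" "\<one>\<^bsub>A\<^esub>"] assms by (simp add: unit_closed unit_r twist_closed)

text \<open>Together the next two lemmas say that \<open>\<alpha>\<close> belongs to the centroid; they are
  hom-associativity with \<open>x = 1\<close> and with \<open>z = 1\<close>.\<close>

lemma mult_twist_right:
  assumes "x \<in> carrier A" "y \<in> carrier A"
  shows "x \<otimes>\<^bsub>A\<^esub> \<alpha> y = \<alpha> (x \<otimes>\<^bsub>A\<^esub> y)"
  using hom_assoc[of "\<one>\<^bsub>A\<^esub>" x y] assms
  by (simp add: unit_closed unit_l twist_eq_left_mult mult_closed)

lemma mult_twist_left:
  assumes "x \<in> carrier A" "y \<in> carrier A"
  shows "\<alpha> x \<otimes>\<^bsub>A\<^esub> y = \<alpha> (x \<otimes>\<^bsub>A\<^esub> y)"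
  using hom_assoc[of x y "\<one>\<^bsub>A\<^esub>"] assms
  by (simp add: unit_closed unit_r twist_eq_right_mult mult_closed)

text \<open>This is what remains of hom-associativity once \<open>\<alpha>\<close> has been pulled out of both sides.\<close>

lemma twist_assoc:
  assumes "x \<in> carrier A" "y \<in> carrier A" "z \<in> carrier A"
  shows "\<alpha> ((x \<otimes>\<^bsub>A\<^esub> y) \<otimes>\<^bsub>A\<^esub> z) = \<alpha> (x \<otimes>\<^bsub>A\<^esub> (y \<otimes>\<^bsub>A\<^esub> z))"
  using hom_assoc[OF assms] assms by (simp add: mult_twist_left mult_twist_right mult_closed)

lemma associates_with_all_twist:
  assumes "x \<in> carrier A"
  shows "associates_with_all A (\<alpha> x)"
  using assms unfolding associates_with_all_def
  by (simp add: mult_twist_left mult_twist_right mult_closed twist_assoc)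

end

section \<open>Multiples of an element\<close>

context nonassoc_algebra
begin

lemma mult_zero_l: "x \<in> carrier A \<Longrightarrow> \<zero>\<^bsub>A\<^esub> \<otimes>\<^bsub>A\<^esub> x = \<zero>\<^bsub>A\<^esub>"
  using mult_smult_l[of "\<zero>" x x] by (simp add: mult_closed)

lemma mult_zero_r: "x \<in> carrier A \<Longrightarrow> x \<otimes>\<^bsub>A\<^esub> \<zero>\<^bsub>A\<^esub> = \<zero>\<^bsub>A\<^esub>"
  using mult_smult_r[of "\<zero>" x x] by (simp add: mult_closed)

lemma submodule_multiples:
  assumes "a \<in> carrier A"
  shows "submodule {x \<otimes>\<^bsub>A\<^esub> a | x. x \<in> carrier A} R A"
proof (rule submoduleI)
  let ?I = "{x \<otimes>\<^bsub>A\<^esub> a | x. x \<in> carrier A}"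
  have I: "x \<otimes>\<^bsub>A\<^esub> a \<in> ?I" if "x \<in> carrier A" for x
    using that by auto
  show closed: "?I \<subseteq> carrier A"
    using assms by (auto simp: mult_closed)
  show "\<zero>\<^bsub>A\<^esub> \<in> ?I"
    using I[of "\<zero>\<^bsub>A\<^esub>"] assms by (simp add: mult_zero_l)
  show smult: "r \<odot>\<^bsub>A\<^esub> b \<in> ?I" if r: "r \<in> carrier R" and b: "b \<in> ?I" for r b
  proof -
    obtain x where "b = x \<otimes>\<^bsub>A\<^esub> a" "x \<in> carrier A"
      using b by auto
    then show ?thesis
      using I[of "r \<odot>\<^bsub>A\<^esub> x"] r assms by (simp add: mult_smult_l)
  qed
  show "\<ominus>\<^bsub>A\<^esub> b \<in> ?I" if b: "b \<in> ?I" for b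
  proof -
    have "b \<in> carrier A"
      using closed b by (rule subsetD)
    then have "\<ominus>\<^bsub>A\<^esub> b = (\<ominus> \<one>) \<odot>\<^bsub>A\<^esub> b"
      by (simp add: smult_l_minus)
    then show ?thesis
      using smult[OF _ b, of "\<ominus> \<one>"] by simp
  qed
  show "b \<oplus>\<^bsub>A\<^esub> c \<in> ?I" if b: "b \<in> ?I" and c: "c \<in> ?I" for b c
  proof -
    obtain x y where "b = x \<otimes>\<^bsub>A\<^esub> a" "x \<in> carrier A" "c = y \<otimes>\<^bsub>A\<^esub> a" "y \<in> carrier A"
      using b c by auto
    then show ?thesis
      using I[of "x \<oplus>\<^bsub>A\<^esub> y"] assms by (simp add: mult_l_distr)
  qed
qed

end

section \<open>The correspondence\<close>

text \<open>The multiples of \<open>\<alpha> 1\<close> are the values of \<open>\<alpha>\<close>, so the conditions on the ideal they form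
  become statements about \<open>\<alpha>\<close> that follow from the centroid property and \<open>twist_assoc\<close>.\<close>

lemma (in unital_hom_assoc_algebra) twist_one_in_AC: "\<alpha> \<one>\<^bsub>A\<^esub> \<in> AC R A"
proof -
  let ?I = "{x \<otimes>\<^bsub>A\<^esub> \<alpha> \<one>\<^bsub>A\<^esub> | x. x \<in> carrier A}"
  have image: "?I = \<alpha> ` carrier A"
    unfolding Setcompr_eq_image by (rule image_cong) (simp_all add: twist_eq_right_mult)
  have "submodule ?I R A"
    by (simp add: submodule_multiples twist_closed unit_closed)
  then have "algebra_ideal R A ?I"
    unfolding algebra_ideal_def image by (auto simp: mult_twist_left mult_twist_right mult_closed)
  moreover have "\<forall>b \<in> ?I. associates_with_all A b"
    unfolding image by (auto simp: associates_with_all_twist)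
  ultimately show ?thesis
    unfolding AC_def by (simp add: twist_closed unit_closed twist_eq_left_mult twist_eq_right_mult)
qed

context unital_nonassoc_algebra
begin

lemma TwistD: "\<alpha> \<in> Twist R A \<Longrightarrow> unital_hom_assoc_algebra R A \<alpha>"
  by (simp add: Twist_def)

lemma TwistI:
  assumes "\<alpha> \<in> extensional (carrier A)"
    and "\<And>x. x \<in> carrier A \<Longrightarrow> \<alpha> x \<in> carrier A"
    and "\<And>x y. \<lbrakk>x \<in> carrier A; y \<in> carrier A\<rbrakk> \<Longrightarrow> \<alpha> (x \<oplus>\<^bsub>A\<^esub> y) = \<alpha> x \<oplus>\<^bsub>A\<^esub> \<alpha> y"
    and "\<And>r x. \<lbrakk>r \<in> carrier R; x \<in> carrier A\<rbrakk> \<Longrightarrow> \<alpha> (r \<odot>\<^bsub>A\<^esub> x) = r \<odot>\<^bsub>A\<^esub> \<alpha> x"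
    and "\<And>x y z. \<lbrakk>x \<in> carrier A; y \<in> carrier A; z \<in> carrier A\<rbrakk> \<Longrightarrow>
      \<alpha> x \<otimes>\<^bsub>A\<^esub> (y \<otimes>\<^bsub>A\<^esub> z) = (x \<otimes>\<^bsub>A\<^esub> y) \<otimes>\<^bsub>A\<^esub> \<alpha> z"
  shows "\<alpha> \<in> Twist R A"
  unfolding Twist_def
  using assms unital_nonassoc_algebra_axioms nonassoc_algebra_axioms
  by (auto intro!: unital_hom_assoc_algebra.intro hom_assoc_algebra.intro
      hom_assoc_algebra_axioms.intro)

lemma Phi_in_AC: "\<alpha> \<in> Twist R A \<Longrightarrow> Phi A \<alpha> \<in> AC R A"
  unfolding Phi_def by (intro unital_hom_assoc_algebra.twist_one_in_AC TwistD)

text \<open>For central \<open>a\<close>, hom-associativity of multiplication by \<open>a\<close> compares \<open>(a x) (y z)\<close> with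
  \<open>(x y) (a z)\<close>. Both equal \<open>(a (x y)) z\<close>: the first because \<open>a x\<close> and \<open>a\<close> are in the nucleus,
  the second because \<open>a\<close> commutes with \<open>x y\<close> and is in the nucleus.\<close>

lemma Psi_in_Twist:
  assumes "a \<in> AC R A"
  shows "Psi A a \<in> Twist R A"
proof -
  have a: "a \<in> carrier A" and central: "\<And>x. x \<in> carrier A \<Longrightarrow> a \<otimes>\<^bsub>A\<^esub> x = x \<otimes>\<^bsub>A\<^esub> a"
    and nucleus: "\<And>x. x \<in> carrier A \<Longrightarrow> associates_with_all A (x \<otimes>\<^bsub>A\<^esub> a)"
    using assms unfolding AC_def by auto
  \<comment> \<open>\<open>a = 1 a\<close> is one of its own multiples.\<close>
  have a_nucleus: "associates_with_all A a"
    using nucleus[OF unit_closed] a by (simp add: unit_l)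
  have "(a \<otimes>\<^bsub>A\<^esub> x) \<otimes>\<^bsub>A\<^esub> (y \<otimes>\<^bsub>A\<^esub> z) = (x \<otimes>\<^bsub>A\<^esub> y) \<otimes>\<^bsub>A\<^esub> (a \<otimes>\<^bsub>A\<^esub> z)"
    if x: "x \<in> carrier A" and y: "y \<in> carrier A" and z: "z \<in> carrier A" for x y z
  proof -
    have "(a \<otimes>\<^bsub>A\<^esub> x) \<otimes>\<^bsub>A\<^esub> (y \<otimes>\<^bsub>A\<^esub> z) = ((a \<otimes>\<^bsub>A\<^esub> x) \<otimes>\<^bsub>A\<^esub> y) \<otimes>\<^bsub>A\<^esub> z"
      using nucleus[OF x] x y z unfolding associates_with_all_def by (simp add: central)
    also have "\<dots> = (a \<otimes>\<^bsub>A\<^esub> (x \<otimes>\<^bsub>A\<^esub> y)) \<otimes>\<^bsub>A\<^esub> z"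
      using a_nucleus x y unfolding associates_with_all_def by simp
    also have "\<dots> = ((x \<otimes>\<^bsub>A\<^esub> y) \<otimes>\<^bsub>A\<^esub> a) \<otimes>\<^bsub>A\<^esub> z"
      using x y by (simp add: central mult_closed)
    also have "\<dots> = (x \<otimes>\<^bsub>A\<^esub> y) \<otimes>\<^bsub>A\<^esub> (a \<otimes>\<^bsub>A\<^esub> z)"
      using a_nucleus x y z mult_closed unfolding associates_with_all_def by metis
    finally show ?thesis .
  qed
  then show ?thesis
    using a by (intro TwistI) (auto simp: Psi_def mult_closed mult_r_distr mult_smult_r)
qed

lemma Psi_Phi:
  assumes "\<alpha> \<in> Twist R A"
  shows "Psi A (Phi A \<alpha>) = \<alpha>"
proof (rule extensionalityI[of _ "carrier A"])
  interpret \<alpha>: unital_hom_assoc_algebra R A \<alpha>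
    using assms by (rule TwistD)
  show "Psi A (Phi A \<alpha>) x = \<alpha> x" if "x \<in> carrier A" for x
    using that by (simp add: Psi_def Phi_def \<alpha>.twist_eq_left_mult)
qed (use assms in \<open>auto simp: Psi_def Twist_def\<close>)

lemma Phi_Psi: "a \<in> AC R A \<Longrightarrow> Phi A (Psi A a) = a"
  by (simp add: Phi_def Psi_def AC_def unit_closed unit_r)

section \<open>The algebra of twisting maps\<close>

lemma Twist_closed: "\<lbrakk>\<alpha> \<in> Twist R A; x \<in> carrier A\<rbrakk> \<Longrightarrow> \<alpha> x \<in> carrier A"
  by (rule hom_assoc_algebra.twist_closed[OF unital_hom_assoc_algebra.axioms(2)[OF TwistD]])

lemma Twist_outside: "\<lbrakk>\<alpha> \<in> Twist R A; x \<notin> carrier A\<rbrakk> \<Longrightarrow> \<alpha> x = undefined"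
  by (rule extensional_arb[of _ "carrier A"]) (simp_all add: Twist_def)

lemma zero_in_Twist: "(\<lambda>x\<in>carrier A. \<zero>\<^bsub>A\<^esub>) \<in> Twist R A"
  by (rule TwistI) (auto simp: mult_zero_l mult_zero_r mult_closed)

lemma add_in_Twist:
  assumes "\<alpha> \<in> Twist R A" "\<beta> \<in> Twist R A"
  shows "(\<lambda>x\<in>carrier A. \<alpha> x \<oplus>\<^bsub>A\<^esub> \<beta> x) \<in> Twist R A"
proof -
  interpret \<alpha>: unital_hom_assoc_algebra R A \<alpha> using assms(1) by (rule TwistD)
  interpret \<beta>: unital_hom_assoc_algebra R A \<beta> using assms(2) by (rule TwistD)
  show ?thesis
    by (rule TwistI)
      (auto simp: \<alpha>.twist_closed \<beta>.twist_closed \<alpha>.twist_add \<beta>.twist_add \<alpha>.twist_smult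
        \<beta>.twist_smult \<alpha>.hom_assoc \<beta>.hom_assoc mult_closed mult_l_distr mult_r_distr
        smult_r_distr M.add.m_ac)
qed

lemma smult_in_Twist:
  assumes "r \<in> carrier R" "\<alpha> \<in> Twist R A"
  shows "(\<lambda>x\<in>carrier A. r \<odot>\<^bsub>A\<^esub> \<alpha> x) \<in> Twist R A"
proof -
  interpret \<alpha>: unital_hom_assoc_algebra R A \<alpha> using assms(2) by (rule TwistD)
  \<comment> \<open>\<open>r \<odot> \<alpha>\<close> is linear because \<open>R\<close> is commutative.\<close>
  have "r \<odot>\<^bsub>A\<^esub> (s \<odot>\<^bsub>A\<^esub> x) = s \<odot>\<^bsub>A\<^esub> (r \<odot>\<^bsub>A\<^esub> x)" if "s \<in> carrier R" "x \<in> carrier A" for s x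
    using that assms(1) by (simp add: smult_assoc1[symmetric] R.m_comm)
  then show ?thesis
    using assms(1)
    by (intro TwistI)
      (auto simp: \<alpha>.twist_closed \<alpha>.twist_add \<alpha>.twist_smult \<alpha>.hom_assoc mult_closed
        mult_smult_l mult_smult_r smult_r_distr)
qed

lemma compose_in_Twist:
  assumes "\<alpha> \<in> Twist R A" "\<beta> \<in> Twist R A"
  shows "compose (carrier A) \<alpha> \<beta> \<in> Twist R A"
proof -
  interpret \<alpha>: unital_hom_assoc_algebra R A \<alpha> using assms(1) by (rule TwistD)
  interpret \<beta>: unital_hom_assoc_algebra R A \<beta> using assms(2) by (rule TwistD)
  show ?thesis
    by (rule TwistI)
      (auto simp: compose_def \<alpha>.twist_closed \<beta>.twist_closed \<alpha>.twist_add \<beta>.twist_add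
        \<alpha>.twist_smult \<beta>.twist_smult \<alpha>.mult_twist_left \<alpha>.mult_twist_right \<beta>.hom_assoc mult_closed)
qed

text \<open>Since \<open>\<beta>\<close> is multiplication by \<open>\<beta> 1\<close>, it commutes with every map that moves through products.\<close>

lemma compose_Twist_commute:
  assumes "\<alpha> \<in> Twist R A" "\<beta> \<in> Twist R A"
  shows "compose (carrier A) \<alpha> \<beta> = compose (carrier A) \<beta> \<alpha>"
proof (rule extensionalityI[of _ "carrier A"])
  interpret \<alpha>: unital_hom_assoc_algebra R A \<alpha> using assms(1) by (rule TwistD)
  interpret \<beta>: unital_hom_assoc_algebra R A \<beta> using assms(2) by (rule TwistD)
  fix x assume x: "x \<in> carrier A"
  have "\<alpha> (\<beta> x) = \<alpha> (\<beta> \<one>\<^bsub>A\<^esub> \<otimes>\<^bsub>A\<^esub> x)"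
    using x by (simp add: \<beta>.twist_eq_left_mult)
  also have "\<dots> = \<beta> \<one>\<^bsub>A\<^esub> \<otimes>\<^bsub>A\<^esub> \<alpha> x"
    using x by (simp add: \<alpha>.mult_twist_right \<beta>.twist_closed unit_closed)
  also have "\<dots> = \<beta> (\<alpha> x)"
    using x by (simp add: \<beta>.twist_eq_left_mult \<alpha>.twist_closed)
  finally show "compose (carrier A) \<alpha> \<beta> x = compose (carrier A) \<beta> \<alpha> x"
    using x by (simp add: compose_def)
qed (auto simp: compose_def)

lemma abelian_group_Twist_algebra: "abelian_group (Twist_algebra R A)"
proof (rule abelian_groupI)
  fix \<alpha> assume \<alpha>: "\<alpha> \<in> carrier (Twist_algebra R A)"
  show "\<zero>\<^bsub>Twist_algebra R A\<^esub> \<oplus>\<^bsub>Twist_algebra R A\<^esub> \<alpha> = \<alpha>"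
    using \<alpha> by (auto simp: Twist_algebra_def fun_eq_iff Twist_closed Twist_outside)
  show "\<exists>\<beta> \<in> carrier (Twist_algebra R A). \<beta> \<oplus>\<^bsub>Twist_algebra R A\<^esub> \<alpha> = \<zero>\<^bsub>Twist_algebra R A\<^esub>"
  \<comment> \<open>Taking the inverse to be the scalar multiple by \<open>-1\<close> makes it a twisting map by \<open>smult_in_Twist\<close>.\<close>
  proof (rule bexI)
    show "(\<lambda>x\<in>carrier A. (\<ominus> \<one>) \<odot>\<^bsub>A\<^esub> \<alpha> x) \<in> carrier (Twist_algebra R A)"
      using \<alpha> by (simp add: Twist_algebra_def smult_in_Twist)
    show "(\<lambda>x\<in>carrier A. (\<ominus> \<one>) \<odot>\<^bsub>A\<^esub> \<alpha> x) \<oplus>\<^bsub>Twist_algebra R A\<^esub> \<alpha> = \<zero>\<^bsub>Twist_algebra R A\<^esub>"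
      using \<alpha> by (auto simp: Twist_algebra_def fun_eq_iff Twist_closed smult_l_minus M.l_neg)
  qed
qed (auto simp: Twist_algebra_def zero_in_Twist add_in_Twist fun_eq_iff Twist_closed M.add.m_ac)

lemma module_Twist_algebra: "module R (Twist_algebra R A)"
  by (rule moduleI[OF is_cring abelian_group_Twist_algebra])
    (auto simp: Twist_algebra_def smult_in_Twist fun_eq_iff Twist_closed Twist_outside
      smult_l_distr smult_r_distr smult_assoc1)

lemma nonassoc_algebra_Twist_algebra: "nonassoc_algebra R (Twist_algebra R A)"
proof (intro nonassoc_algebra.intro nonassoc_algebra_axioms.intro module_Twist_algebra)
  fix \<alpha> \<beta> \<gamma> r
  assume \<alpha>: "\<alpha> \<in> carrier (Twist_algebra R A)" and \<beta>: "\<beta> \<in> carrier (Twist_algebra R A)"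
  interpret \<alpha>: unital_hom_assoc_algebra R A \<alpha>
    using \<alpha> by (simp add: Twist_algebra_def TwistD)
  show "\<alpha> \<otimes>\<^bsub>Twist_algebra R A\<^esub> \<beta> \<in> carrier (Twist_algebra R A)"
    using \<alpha> \<beta> by (simp add: Twist_algebra_def compose_in_Twist)
  show "(\<alpha> \<oplus>\<^bsub>Twist_algebra R A\<^esub> \<beta>) \<otimes>\<^bsub>Twist_algebra R A\<^esub> \<gamma> =
      (\<alpha> \<otimes>\<^bsub>Twist_algebra R A\<^esub> \<gamma>) \<oplus>\<^bsub>Twist_algebra R A\<^esub> (\<beta> \<otimes>\<^bsub>Twist_algebra R A\<^esub> \<gamma>)"
    if "\<gamma> \<in> carrier (Twist_algebra R A)"
    using that by (auto simp: Twist_algebra_def compose_def fun_eq_iff Twist_closed)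
  show "\<alpha> \<otimes>\<^bsub>Twist_algebra R A\<^esub> (\<beta> \<oplus>\<^bsub>Twist_algebra R A\<^esub> \<gamma>) =
      (\<alpha> \<otimes>\<^bsub>Twist_algebra R A\<^esub> \<beta>) \<oplus>\<^bsub>Twist_algebra R A\<^esub> (\<alpha> \<otimes>\<^bsub>Twist_algebra R A\<^esub> \<gamma>)"
    if "\<gamma> \<in> carrier (Twist_algebra R A)"
    using that \<beta> by (auto simp: Twist_algebra_def compose_def fun_eq_iff Twist_closed \<alpha>.twist_add)
  show "(r \<odot>\<^bsub>Twist_algebra R A\<^esub> \<alpha>) \<otimes>\<^bsub>Twist_algebra R A\<^esub> \<beta> =
      r \<odot>\<^bsub>Twist_algebra R A\<^esub> (\<alpha> \<otimes>\<^bsub>Twist_algebra R A\<^esub> \<beta>)"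
    using \<beta> by (auto simp: Twist_algebra_def compose_def fun_eq_iff Twist_closed)
  show "\<alpha> \<otimes>\<^bsub>Twist_algebra R A\<^esub> (r \<odot>\<^bsub>Twist_algebra R A\<^esub> \<beta>) =
      r \<odot>\<^bsub>Twist_algebra R A\<^esub> (\<alpha> \<otimes>\<^bsub>Twist_algebra R A\<^esub> \<beta>)"
    if "r \<in> carrier R"
    using that \<beta>
    by (auto simp: Twist_algebra_def compose_def fun_eq_iff Twist_closed \<alpha>.twist_smult)
qed

lemma comm_assoc_algebra_Twist_algebra: "comm_assoc_algebra R (Twist_algebra R A)"
proof (intro comm_assoc_algebra.intro comm_assoc_algebra_axioms.intro
    nonassoc_algebra_Twist_algebra)
  fix \<alpha> \<beta> \<gamma>
  assume \<alpha>: "\<alpha> \<in> carrier (Twist_algebra R A)" and \<beta>: "\<beta> \<in> carrier (Twist_algebra R A)"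
  show "(\<alpha> \<otimes>\<^bsub>Twist_algebra R A\<^esub> \<beta>) \<otimes>\<^bsub>Twist_algebra R A\<^esub> \<gamma> =
      \<alpha> \<otimes>\<^bsub>Twist_algebra R A\<^esub> (\<beta> \<otimes>\<^bsub>Twist_algebra R A\<^esub> \<gamma>)"
    if "\<gamma> \<in> carrier (Twist_algebra R A)"
    using that by (auto simp: Twist_algebra_def compose_def fun_eq_iff Twist_closed)
  show "\<alpha> \<otimes>\<^bsub>Twist_algebra R A\<^esub> \<beta> = \<beta> \<otimes>\<^bsub>Twist_algebra R A\<^esub> \<alpha>"
    using \<alpha> \<beta> by (simp add: Twist_algebra_def compose_Twist_commute)
qed

end

theorem proposition1p3:
  fixes R :: "('k, 'r) ring_scheme" and A :: "('k, 'a, 'm) module_scheme"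
  assumes "unital_nonassoc_algebra R A"
  shows "comm_assoc_algebra R (Twist_algebra R A) \<and>
    bij_betw (Phi A) (Twist R A) (AC R A) \<and>
    bij_betw (Psi A) (AC R A) (Twist R A) \<and>
    (\<forall>\<alpha> \<in> Twist R A. Psi A (Phi A \<alpha>) = \<alpha>) \<and>
    (\<forall>x \<in> AC R A. Phi A (Psi A x) = x)"
proof -
  interpret unital_nonassoc_algebra R A
    by (rule assms)
  have "bij_betw (Phi A) (Twist R A) (AC R A)"
    by (rule bij_betw_byWitness[where f' = "Psi A"])
      (auto simp: Psi_Phi Phi_Psi Phi_in_AC Psi_in_Twist)
  moreover have "bij_betw (Psi A) (AC R A) (Twist R A)"
    by (rule bij_betw_byWitness[where f' = "Phi A"])
      (auto simp: Psi_Phi Phi_Psi Phi_in_AC Psi_in_Twist)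
  ultimately show ?thesis
    by (simp add: comm_assoc_algebra_Twist_algebra Psi_Phi Phi_Psi)
qed

end
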